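(* Let $d,k,n$ be positive integers with $k\le n$ and let $x_1,\dots,x_n\in\mathbb{R}^d$. Run the global k-means cutting plane algorithm (described in the context) on this data with tolerance $\epsilon=0$, where at each iteration arbitrary optimal solutions of the subproblems are selected as specified there, and let $L_N$ and $U_N$ denote the lower bound and the upper bound held by the algorithm after iteration $N$. Then the gap between the upper bound and the lower bound converges to $0$: $$\lim_{N\to\infty}(U_N-L_N)=0.$$
   Context: Notation: $\|\cdot\|$ is the Euclidean norm, $\langle A,B\rangle=\operatorname{tr}(A^TB)$ is the Frobenius inner product, $\mathbf{1}$ is the all-ones column vector of appropriate dimension, $\mathbf{1}_{(d+1)\times k}$ is the all-ones matrix, and inequalities between vectors are entrywise. Let $X=(x_1,\dots,x_n)\in\mathbb{R}^{d\times n}$, $c_0=\sum_{i=1}^n\|x_i\|^2$, and $$\mathcal{X}=\begin{pmatrix}X\\ \mathbf{1}^T\end{pmatrix}\in\mathbb{R}^{(d+1)\times n},\quad C=\begin{pmatrix}I_{d\times d}&0_{d\times1}\end{pmatrix},\quad D=\begin{pmatrix}0_{1\times d}&1\end{pmatrix}.$$ Assignment matrices and their relaxation: $$\mathcal{A}=\{\Gamma\in\{0,1\}^{n\times k}:\Gamma\mathbf{1}=\mathbf{1},\ \Gamma^T\mathbf{1}\ge\mathbf{1}\},\qquad \overline{\mathcal{A}}=\{\Gamma\in[0,1]^{n\times k}:\Gamma\mathbf{1}=\mathbf{1},\ \Gamma^T\mathbf{1}\ge\mathbf{1}\}.$$ For $Z=(z_1,\dots,z_k)\in\mathbb{R}^{(d+1)\times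 k}$ with $Dz_j>0$ for all $j$, define $$F(Z)=c_0+\sum_{j=1}^k f(z_j),\qquad f(z)=-\frac{\|Cz\|^2}{Dz},\qquad \nabla f(z)=-\Big(\frac{2C^TCz}{Dz}-\frac{\|Cz\|^2}{(Dz)^2}D^T\Big).$$ (The k-means problem is the minimization of $F(\mathcal{X}\Gamma)$ over $\Gamma\in\mathcal{A}$.) Initial polytope: $P_0\subset\mathbb{R}^{(d+1)\times k}$ is the set of $Z$ satisfying $$Z_{ij}\ge\min_{\Gamma\in\overline{\mathcal{A}}}(\mathcal{X}\Gamma)_{ij}\quad(1\le i\le d+1,\ 1\le j\le k),\qquad \langle\mathbf{1}_{(d+1)\times k},Z\rangle\le\max_{\Gamma\in\overline{\mathcal{A}}}\langle\mathbf{1}_{(d+1)\times k},\mathcal{X}\Gamma\rangle.$$ (In particular $Dz_j\ge1$ for all $j$ and all $Z\in P_0$.) Algorithm with tolerance $\epsilon\ge0$: set the upper bound $U_{-1}=+\infty$. For $N=0,1,2,\dots$: 1. Let $Z_N=(z_1^N,\dots,z_k^N)$ be an optimal solution of the relaxed problem $\min_{Z\in P_N}F(Z)$, and set the lower bound $L_N=F(Z_N)$. 2. Let $\mathcal{D}_N=(\nabla f(z_1^N),\dots,\nabla f(z_k^N))\in\mathbb{R}^{(d+1)\times k}$, let $b_N=\min_{\Gamma\in\overline{\mathcal{A}}}\langle\mathcal{D}_N,\mathcal{X}\Gamma\rangle$, and let $\Gamma_N\in\mathcal{A}$ be an optimal solution of this linear problem. 3. Set the upper bound $U_N=\min(U_{N-1},F(\mathcal{X}\Gamma_N))$.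 4. Add the cutting plane: $P_{N+1}=P_N\cap\{Z:\langle\mathcal{D}_N,Z\rangle\ge b_N\}$. 5. Stop if $U_N-L_N<\epsilon$; otherwise continue with $N+1$. (With $\epsilon=0$ the algorithm does not stop, since $U_N\ge L_N$ always, and it generates infinite sequences $(L_N)$ and $(U_N)$.) *)

theory Defs
  imports "HOL-Analysis.Analysis"
begin

text \<open>
  An \<open>m \<times> n\<close> matrix is a \<open>real ^ 'n ^ 'm\<close>, so \<open>d\<close>, \<open>k\<close>, \<open>n\<close> are \<open>CARD('d)\<close>, \<open>CARD('k)\<close>,
  \<open>CARD('n)\<close> and are automatically positive. The \<open>d + 1\<close> rows of a lifted matrix are indexed by
  \<open>'d option\<close>: \<open>Some i\<close> is row \<open>i \<le> d\<close>, and \<open>None\<close> is row \<open>d + 1\<close>.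
  The library operations \<open>1\<close> and \<open>\<le>\<close> on vectors are componentwise. Hence \<open>1\<close> is the all-ones
  vector, and at a matrix type the all-ones matrix (the identity matrix is \<open>mat 1\<close>).
\<close>

definition frobenius :: "real ^ 'n ^ 'm \<Rightarrow> real ^ 'n ^ 'm \<Rightarrow> real" where
  "frobenius A B = trace (transpose A ** B)"

lemma frobenius_eq_inner: "frobenius A B = A \<bullet> B"
  unfolding frobenius_def trace_def matrix_matrix_mult_def transpose_def inner_vec_def
  by (simp add: sum.swap[of _ "UNIV :: 'b set"])

text \<open>Minimum and maximum of a function on a set; unspecified if not attained.\<close>

definition min_over :: "('a \<Rightarrow> real) \<Rightarrow> 'a set \<Rightarrow> real" where
  "min_over g S = (LEAST v. v \<in> g ` S)"

definition max_over :: "('a \<Rightarrow> real) \<Rightarrow> 'a set \<Rightarrow> real" where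
  "max_over g S = (GREATEST v. v \<in> g ` S)"

definition lift_data :: "real ^ 'n ^ 'd \<Rightarrow> real ^ 'n ^ ('d::finite) option" where
  "lift_data X = (\<chi> i j. case i of Some r \<Rightarrow> X $ r $ j | None \<Rightarrow> 1)"

definition C_mat :: "real ^ ('d::finite) option ^ 'd" where
  "C_mat = (\<chi> i j. if j = Some i then 1 else 0)"

text \<open>The single row of \<open>D\<close>, as a vector: \<open>D z\<close> is \<open>D_row \<bullet> z\<close>, and \<open>D\<^sup>T\<close> is \<open>D_row\<close>.\<close>

definition D_row :: "real ^ ('d::finite) option" where
  "D_row = (\<chi> j. if j = None then 1 else 0)"

definition assignments :: "(real ^ 'k ^ 'n) set" where
  "assignments = {\<Gamma>. (\<forall>i j. \<Gamma> $ i $ j \<in> {0, 1}) \<and> \<Gamma> *v 1 = 1 \<and> transpose \<Gamma> *v 1 \<ge> 1}"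

definition relaxed_assignments :: "(real ^ 'k ^ 'n) set" where
  "relaxed_assignments =
    {\<Gamma>. (\<forall>i j. \<Gamma> $ i $ j \<in> {0..1}) \<and> \<Gamma> *v 1 = 1 \<and> transpose \<Gamma> *v 1 \<ge> 1}"

definition kmeans_f :: "real ^ ('d::finite) option \<Rightarrow> real" where
  "kmeans_f z = - ((norm (C_mat *v z))\<^sup>2 / (D_row \<bullet> z))"

definition grad_f :: "real ^ ('d::finite) option \<Rightarrow> real ^ ('d::finite) option" where
  "grad_f z = - ((2 / (D_row \<bullet> z)) *\<^sub>R (transpose C_mat *v (C_mat *v z))
                 - ((norm (C_mat *v z))\<^sup>2 / (D_row \<bullet> z)\<^sup>2) *\<^sub>R D_row)"

definition kmeans_F :: "real ^ 'n ^ 'd \<Rightarrow> real ^ 'k ^ ('d::finite) option \<Rightarrow> real" where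
  "kmeans_F X Z = (\<Sum>i\<in>UNIV. (norm (column i X))\<^sup>2) + (\<Sum>j\<in>UNIV. kmeans_f (column j Z))"

definition grad_mat :: "real ^ 'k ^ ('d::finite) option \<Rightarrow> real ^ 'k ^ ('d::finite) option" where
  "grad_mat Z = (\<chi> i j. grad_f (column j Z) $ i)"

definition initial_polytope :: "real ^ 'n ^ 'd \<Rightarrow> (real ^ 'k ^ ('d::finite) option) set" where
  "initial_polytope X =
    {Z. (\<forall>i j. Z $ i $ j \<ge> min_over (\<lambda>\<Gamma>. (lift_data X ** \<Gamma>) $ i $ j) relaxed_assignments) \<and>
        frobenius 1 Z \<le> max_over (\<lambda>\<Gamma>. frobenius 1 (lift_data X ** \<Gamma>))
            (relaxed_assignments :: (real ^ 'k ^ 'n) set)}"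

text \<open>The right-hand side \<open>b\<^sub>N\<close> of the cut generated at \<open>Z = Z\<^sub>N\<close>.\<close>

definition cut_bound :: "real ^ 'n ^ 'd \<Rightarrow> real ^ 'k ^ ('d::finite) option \<Rightarrow> real" where
  "cut_bound X Z =
    min_over (\<lambda>\<Gamma>. frobenius (grad_mat Z) (lift_data X ** \<Gamma>)) relaxed_assignments"

primrec polytope_seq ::
  "real ^ 'n ^ 'd \<Rightarrow> (nat \<Rightarrow> real ^ 'k ^ ('d::finite) option) \<Rightarrow> nat
    \<Rightarrow> (real ^ 'k ^ ('d::finite) option) set" where
  "polytope_seq X Z 0 = initial_polytope X"
| "polytope_seq X Z (Suc N) =
    polytope_seq X Z N \<inter> {W. frobenius (grad_mat (Z N)) W \<ge> cut_bound X (Z N)}"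

definition lower_bound :: "real ^ 'n ^ 'd \<Rightarrow> (nat \<Rightarrow> real ^ 'k ^ ('d::finite) option) \<Rightarrow> nat \<Rightarrow> real" where
  "lower_bound X Z N = kmeans_F X (Z N)"

text \<open>The upper bound held before iteration \<open>N\<close>, that is \<open>U\<^bsub>N-1\<^esub>\<close>, starting from \<open>U\<^bsub>-1\<^esub> = \<infinity>\<close>.\<close>

primrec upper_before :: "real ^ 'n ^ 'd \<Rightarrow> (nat \<Rightarrow> real ^ 'k ^ 'n) \<Rightarrow> nat \<Rightarrow> ereal" where
  "upper_before X \<Gamma> 0 = \<infinity>"
| "upper_before X \<Gamma> (Suc N) = min (upper_before X \<Gamma> N) (ereal (kmeans_F X (lift_data X ** \<Gamma> N)))"

definition upper_bound :: "real ^ 'n ^ 'd \<Rightarrow> (nat \<Rightarrow> real ^ 'k ^ 'n) \<Rightarrow> nat \<Rightarrow> ereal" where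
  "upper_bound X \<Gamma> N = upper_before X \<Gamma> (Suc N)"

definition gap ::
  "real ^ 'n ^ 'd \<Rightarrow> (nat \<Rightarrow> real ^ 'k ^ ('d::finite) option)
    \<Rightarrow> (nat \<Rightarrow> real ^ 'k ^ 'n) \<Rightarrow> nat \<Rightarrow> ereal" where
  "gap X Z \<Gamma> N = upper_bound X \<Gamma> N - ereal (lower_bound X Z N)"

text \<open>
  \<open>Z\<close> and \<open>\<Gamma>\<close> record the choices made in a run with tolerance \<open>\<epsilon>\<close>. Iteration \<open>N\<close> is executed only
  if the stopping test failed at all earlier iterations; entries after termination are
  unconstrained. In particular, that a run never stops is not part of the definition.
\<close>

definition cutting_plane_run ::
  "real \<Rightarrow> real ^ 'n ^ 'd \<Rightarrow> (nat \<Rightarrow> real ^ 'k ^ ('d::finite) option)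
    \<Rightarrow> (nat \<Rightarrow> real ^ 'k ^ 'n) \<Rightarrow> bool" where
  "cutting_plane_run \<epsilon> X Z \<Gamma> \<longleftrightarrow>
    (\<forall>N. (\<forall>M<N. \<not> gap X Z \<Gamma> M < ereal \<epsilon>) \<longrightarrow>
      is_arg_min (kmeans_F X) (\<lambda>W. W \<in> polytope_seq X Z N) (Z N) \<and>
      \<Gamma> N \<in> assignments \<and>
      is_arg_min (\<lambda>G. frobenius (grad_mat (Z N)) (lift_data X ** G))
        (\<lambda>G. G \<in> relaxed_assignments) (\<Gamma> N))"

end

theory Submission
  imports Defs
begin

text \<open>
  Why the gap closes. The function \<open>f\<close> is concave and homogeneous of degree one, so
  \<open>f w \<le> \<nabla>f(z) \<bullet> w\<close> with equality at \<open>w = z\<close>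
  (\<open>kmeans_f_le_grad\<close>, \<open>grad_f_self\<close>). Two consequences carry the proof.

  A lifted relaxed assignment \<open>\<X>\<Gamma>\<close> satisfies the constraints of \<open>P\<^sub>0\<close> and every cut, because the
  right-hand sides are extrema over exactly these points (\<open>lift_mult_in_polytope_seq\<close>). Hence
  \<open>L\<^sub>N \<le> U\<^sub>N\<close>, a run with tolerance \<open>0\<close> never stops (\<open>run_never_stops\<close>), and the gap is nonnegative;
  it is nonincreasing, since the polytopes shrink and \<open>U\<close> is a running minimum.

  Conversely, linearising \<open>F\<close> at \<open>Z\<^sub>N\<close> gives
  \<open>U\<^sub>N - L\<^sub>N \<le> \<langle>\<D>\<^sub>N, \<X>\<Gamma>\<^sub>N - Z\<^sub>N\<rangle> = b\<^sub>N - \<langle>\<D>\<^sub>N, Z\<^sub>N\<rangle>\<close>,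
  the amount by which \<open>Z\<^sub>N\<close> violates its own cut. Every later iterate satisfies that cut,
  so for \<open>M > N\<close> the gap at \<open>N\<close> is at most \<open>\<langle>\<D>\<^sub>N, Z\<^sub>M - Z\<^sub>N\<rangle> \<le> \<parallel>\<D>\<^sub>N\<parallel> \<parallel>Z\<^sub>M - Z\<^sub>N\<parallel>\<close>.
  On \<open>P\<^sub>0\<close> the last row is at least \<open>1\<close> and \<open>P\<^sub>0\<close> is bounded, so the gradients are uniformly bounded
  (\<open>bounded_grad_mat\<close>), and two of the iterates come arbitrarily close to each
  other (\<open>bounded_sequence_close_pair\<close>). The gap is therefore small at some \<open>N\<close>, and by
  monotonicity from then on.
\<close>

section \<open>The objective and its gradient\<close>

lemma D_row_inner: "D_row \<bullet> z = z $ None"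
  by (simp add: D_row_def inner_vec_def if_distrib[of "\<lambda>x. x * _"] cong: if_cong)

lemma grad_f_inner:
  "grad_f z \<bullet> w = - (2 * ((C_mat *v z) \<bullet> (C_mat *v w)) / (D_row \<bullet> z)
      - (norm (C_mat *v z))\<^sup>2 * (D_row \<bullet> w) / (D_row \<bullet> z)\<^sup>2)"
proof -
  have "(transpose C_mat *v (C_mat *v z)) \<bullet> w = (C_mat *v z) \<bullet> (C_mat *v w)"
    by (metis dot_lmul_matrix transpose_matrix_vector)
  then show ?thesis
    by (simp add: grad_f_def inner_diff_left inner_minus_left)
qed

text \<open>
  Euler's identity for the degree-one homogeneous function \<open>f\<close>.
\<close>

lemma grad_f_self:
  assumes "D_row \<bullet> z > 0"
  shows "grad_f z \<bullet> z = kmeans_f z"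
  using assms
  by (simp add: grad_f_inner kmeans_f_def dot_square_norm power2_eq_square)

text \<open>
  This is the supergradient inequality of the concave function \<open>f\<close>: the constant term of the
  tangent at \<open>z\<close> vanishes by Euler's identity. With \<open>a = C z\<close>, \<open>s = D z\<close>, \<open>b = C w\<close>, \<open>t = D w\<close>, the
  difference of the two sides is the completed square \<open>t \<parallel>b/t - a/s\<parallel>\<^sup>2\<close>.
\<close>

lemma kmeans_f_le_grad:
  assumes z: "D_row \<bullet> z > 0" and w: "D_row \<bullet> w > 0"
  shows "kmeans_f w \<le> grad_f z \<bullet> w"
proof -
  define a b s t where "a = C_mat *v z" and "b = C_mat *v w"
    and "s = D_row \<bullet> z" and "t = D_row \<bullet> w"
  have st: "s > 0" "t > 0"
    using z w by (simp_all add: s_def t_def)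
  have "0 \<le> t * (norm (b /\<^sub>R t - a /\<^sub>R s))\<^sup>2"
    using st by simp
  also have "\<dots> = (norm b)\<^sup>2 / t - 2 * (a \<bullet> b) / s + (norm a)\<^sup>2 * t / s\<^sup>2"
    using st unfolding power2_norm_eq_inner
    by (simp add: inner_diff_left inner_diff_right inner_commute field_simps power2_eq_square)
  finally show ?thesis
    unfolding grad_f_inner kmeans_f_def
    by (simp add: a_def b_def s_def t_def)
qed

lemma frobenius_grad_mat:
  "frobenius (grad_mat Z) W = (\<Sum>j\<in>UNIV. grad_f (column j Z) \<bullet> column j W)"
  unfolding frobenius_eq_inner grad_mat_def
  by (simp add: inner_vec_def column_def) (rule sum.swap)

lemma D_row_column: "D_row \<bullet> column j Z = Z $ None $ j"
  by (simp add: D_row_inner column_def)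

lemma kmeans_F_diff_le:
  assumes "\<And>j. Z $ None $ j > 0" and "\<And>j. W $ None $ j > 0"
  shows "kmeans_F X W - kmeans_F X Z \<le> frobenius (grad_mat Z) W - frobenius (grad_mat Z) Z"
proof -
  have "(\<Sum>j\<in>UNIV. kmeans_f (column j W)) \<le> frobenius (grad_mat Z) W"
    unfolding frobenius_grad_mat
    by (intro sum_mono kmeans_f_le_grad) (simp_all add: D_row_column assms)
  moreover have "frobenius (grad_mat Z) Z = (\<Sum>j\<in>UNIV. kmeans_f (column j Z))"
    unfolding frobenius_grad_mat
    by (intro sum.cong grad_f_self) (simp_all add: D_row_column assms)
  ultimately show ?thesis
    by (simp add: kmeans_F_def)
qed

text \<open>
  The gradient blows up only where \<open>D z\<close> approaches \<open>0\<close>. A bounded set on which the last row is at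
  least \<open>1\<close> lies in a compact set on which \<open>grad_mat\<close> is continuous.
\<close>

lemma bounded_grad_mat:
  fixes S :: "(real ^ 'k ^ ('d::finite) option) set"
  assumes "bounded S" and "\<And>Z j. Z \<in> S \<Longrightarrow> Z $ None $ j \<ge> 1"
  shows "bounded (grad_mat ` S)"
proof -
  obtain R where R: "\<And>Z. Z \<in> S \<Longrightarrow> norm Z \<le> R"
    using assms(1) by (auto simp: bounded_iff)
  define K :: "(real ^ 'k ^ 'd option) set"
    where "K = cball 0 R \<inter> {Z. \<forall>j. 1 \<le> Z $ None $ j}"
  have "closed {Z :: real ^ 'k ^ 'd option. \<forall>j. 1 \<le> Z $ None $ j}"
    by (intro closed_Collect_all closed_Collect_le continuous_intros)
  then have "compact K"
    unfolding K_def by (intro compact_Int_closed compact_cball)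
  moreover have "continuous_on K grad_mat"
  proof -
    have "Z $ None $ j \<noteq> 0" if "Z \<in> K" for Z j
    proof -
      have "1 \<le> Z $ None $ j" using that by (simp add: K_def)
      then show ?thesis by auto
    qed
    then show ?thesis
      unfolding grad_mat_def grad_f_def column_def D_row_inner matrix_vector_mult_def
      by (intro continuous_intros) auto
  qed
  ultimately have "bounded (grad_mat ` K)"
    by (intro compact_imp_bounded compact_continuous_image)
  moreover have "S \<subseteq> K"
    using R assms(2) by (auto simp: K_def)
  ultimately show ?thesis
    by (meson bounded_subset image_mono)
qed

section \<open>The polytopes\<close>

lemma min_over_attained:
  assumes "is_arg_min g (\<lambda>x. x \<in> S) x"
  shows "min_over g S = g x"
  unfolding min_over_def
  using assms by (intro Least_equality) (auto simp: is_arg_min_linorder)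

text \<open>
  As \<open>min_over\<close> is a least element, it bounds the values of \<open>g\<close> from below only once the minimum is
  known to be attained; compactness of \<open>S\<close> provides this.
\<close>

lemma min_over_le:
  assumes "compact S" "continuous_on S g" "x \<in> S"
  shows "min_over g S \<le> g x"
proof -
  obtain y where "y \<in> S" "\<forall>z\<in>S. g y \<le> g z"
    using continuous_attains_inf[of S g] assms by auto
  then have "min_over g S = g y"
    by (intro min_over_attained) (auto simp: is_arg_min_linorder)
  then show ?thesis using \<open>\<forall>z\<in>S. g y \<le> g z\<close> assms(3) by simp
qed

lemma min_over_ge:
  assumes "compact S" "continuous_on S g" "S \<noteq> {}" "\<And>x. x \<in> S \<Longrightarrow> c \<le> g x"
  shows "c \<le> min_over g S"
proof -
  obtain y where y: "y \<in> S" "\<forall>z\<in>S. g y \<le> g z"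
    using continuous_attains_inf[of S g] assms by auto
  then have "min_over g S = g y"
    by (intro min_over_attained) (auto simp: is_arg_min_linorder)
  then show ?thesis using y assms(4) by simp
qed

lemma max_over_ge:
  assumes "compact S" "continuous_on S g" "x \<in> S"
  shows "g x \<le> max_over g S"
proof -
  obtain y where y: "y \<in> S" "\<forall>z\<in>S. g z \<le> g y"
    using continuous_attains_sup[of S g] assms by auto
  then have "max_over g S = g y"
    unfolding max_over_def by (intro Greatest_equality) auto
  then show ?thesis using y assms(3) by simp
qed

lemma compact_relaxed_assignments:
  "compact (relaxed_assignments :: (real ^ 'k ^ 'n) set)"
proof -
  have eq: "(relaxed_assignments :: (real ^ 'k ^ 'n) set) =
    {\<Gamma>. \<forall>i j. 0 \<le> \<Gamma> $ i $ j} \<inter> {\<Gamma>. \<forall>i j. \<Gamma> $ i $ j \<le> 1} \<inter> {\<Gamma>. \<forall>i. (\<Sum>j\<in>UNIV. \<Gamma> $ i $ j) = 1}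
      \<inter> {\<Gamma>. \<forall>j. 1 \<le> (\<Sum>i\<in>UNIV. \<Gamma> $ i $ j)}"
    by (auto simp: relaxed_assignments_def matrix_vector_mult_def transpose_def vec_eq_iff
        less_eq_vec_def)
  have "closed (relaxed_assignments :: (real ^ 'k ^ 'n) set)"
    unfolding eq
    by (intro closed_Int closed_Collect_all closed_Collect_le closed_Collect_eq continuous_intros)
  moreover have "(relaxed_assignments :: (real ^ 'k ^ 'n) set) \<subseteq> cbox 0 1"
    by (auto simp: eq mem_box_cart cbox_def Basis_vec_def inner_axis)
  ultimately show ?thesis
    by (meson bounded_cbox bounded_subset compact_eq_bounded_closed)
qed

lemma continuous_on_lift_mult:
  "continuous_on S (\<lambda>\<Gamma>. lift_data X ** \<Gamma>)"
  unfolding matrix_matrix_mult_def by (intro continuous_intros)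

text \<open>
  The last row of \<open>\<X>\<close> is all ones, so the last row of \<open>\<X>\<Gamma>\<close> holds the cluster sizes, each at least \<open>1\<close>.
\<close>

lemma lift_mult_None_ge_1:
  assumes "\<Gamma> \<in> relaxed_assignments"
  shows "1 \<le> (lift_data X ** \<Gamma>) $ None $ j"
  using assms
  by (auto simp: relaxed_assignments_def lift_data_def matrix_matrix_mult_def
      matrix_vector_mult_def transpose_def less_eq_vec_def)

lemma lift_mult_in_initial_polytope:
  fixes X :: "real ^ 'n ^ 'd::finite" and \<Gamma> :: "real ^ 'k ^ 'n"
  assumes "\<Gamma> \<in> relaxed_assignments"
  shows "lift_data X ** \<Gamma> \<in> initial_polytope X"
proof -
  have "min_over (\<lambda>\<Gamma>. (lift_data X ** \<Gamma>) $ i $ j) relaxed_assignments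
      \<le> (lift_data X ** \<Gamma>) $ i $ j" for i j
    using compact_relaxed_assignments _ assms
    by (rule min_over_le) (intro continuous_intros continuous_on_lift_mult)
  moreover have "frobenius 1 (lift_data X ** \<Gamma>)
      \<le> max_over (\<lambda>\<Gamma> :: real ^ 'k ^ 'n. frobenius 1 (lift_data X ** \<Gamma>)) relaxed_assignments"
    using compact_relaxed_assignments _ assms unfolding frobenius_eq_inner
    by (rule max_over_ge) (intro continuous_intros continuous_on_lift_mult)
  ultimately show ?thesis
    by (simp add: initial_polytope_def)
qed

text \<open>
  The bound on the cluster sizes passes from the lifted assignments to \<open>P\<^sub>0\<close> through the
  entrywise lower bounds. Nonemptiness makes these bounds attained minima.
\<close>

lemma initial_polytope_None_ge_1:
  fixes X :: "real ^ 'n ^ 'd::finite" and Z :: "real ^ 'k ^ 'd option"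
  assumes "(relaxed_assignments :: (real ^ 'k ^ 'n) set) \<noteq> {}" and "Z \<in> initial_polytope X"
  shows "1 \<le> Z $ None $ j"
proof -
  have "1 \<le> min_over (\<lambda>\<Gamma>. (lift_data X ** \<Gamma>) $ None $ j)
      (relaxed_assignments :: (real ^ 'k ^ 'n) set)"
    using compact_relaxed_assignments _ assms(1) lift_mult_None_ge_1
    by (rule min_over_ge) (intro continuous_intros continuous_on_lift_mult)
  also have "\<dots> \<le> Z $ None $ j"
    using assms(2) by (simp add: initial_polytope_def)
  finally show ?thesis .
qed

text \<open>
  The nonnegative entries of \<open>Z - m\<close> add up to at most \<open>B - \<langle>1, m\<rangle>\<close>, which bounds the
  \<open>\<ell>\<^sub>1\<close> norm of \<open>Z - m\<close> and hence its Euclidean norm.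
\<close>

lemma bounded_entries_ge_frobenius_le:
  fixes m :: "real ^ 'k ^ 'm"
  shows "bounded {Z. (\<forall>i j. m $ i $ j \<le> Z $ i $ j) \<and> frobenius 1 Z \<le> B}"
proof (rule bounded_subset[OF bounded_cball])
  show "{Z. (\<forall>i j. m $ i $ j \<le> Z $ i $ j) \<and> frobenius 1 Z \<le> B} \<subseteq> cball m (B - frobenius 1 m)"
  proof clarify
    fix Z :: "real ^ 'k ^ 'm"
    assume m: "\<forall>i j. m $ i $ j \<le> Z $ i $ j" and B: "frobenius 1 Z \<le> B"
    have "norm (Z - m) \<le> (\<Sum>i\<in>UNIV. norm ((Z - m) $ i))"
      unfolding norm_vec_def by (intro L2_set_le_sum) simp
    also have "\<dots> \<le> (\<Sum>i\<in>UNIV. \<Sum>j\<in>UNIV. \<bar>(Z - m) $ i $ j\<bar>)"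
      by (intro sum_mono norm_le_l1_cart)
    also have "\<dots> = frobenius 1 Z - frobenius 1 m"
      using m by (simp add: frobenius_eq_inner inner_vec_def sum_subtractf)
    finally show "Z \<in> cball m (B - frobenius 1 m)"
      using B by (simp add: dist_norm norm_minus_commute)
  qed
qed

lemma bounded_initial_polytope:
  fixes X :: "real ^ 'n ^ 'd::finite"
  shows "bounded (initial_polytope X :: (real ^ 'k ^ 'd option) set)"
  by (rule bounded_subset[OF bounded_entries_ge_frobenius_le[of
        "\<chi> i j. min_over (\<lambda>\<Gamma> :: real ^ 'k ^ 'n. (lift_data X ** \<Gamma>) $ i $ j) relaxed_assignments"]])
    (auto simp: initial_polytope_def)

lemma polytope_seq_antimono:
  assumes "M \<le> N"
  shows "polytope_seq X Z N \<subseteq> polytope_seq X Z M"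
  using assms by (induction rule: dec_induct) auto

text \<open>
  No cut removes a lifted relaxed assignment, because \<open>b\<^sub>M\<close> is the minimum of the cutting functional
  over them.
\<close>

lemma lift_mult_in_polytope_seq:
  fixes X :: "real ^ 'n ^ 'd::finite"
  assumes "G \<in> relaxed_assignments"
    and "\<And>M. M < N \<Longrightarrow> is_arg_min (\<lambda>G. frobenius (grad_mat (Z M)) (lift_data X ** G))
        (\<lambda>G. G \<in> relaxed_assignments) (\<Gamma> M)"
  shows "lift_data X ** G \<in> polytope_seq X Z N"
  using assms(2)
proof (induction N)
  case 0
  then show ?case
    using lift_mult_in_initial_polytope assms(1) by simp
next
  case (Suc N)
  then have arg: "is_arg_min (\<lambda>G. frobenius (grad_mat (Z N)) (lift_data X ** G))
        (\<lambda>G. G \<in> relaxed_assignments) (\<Gamma> N)"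
    by simp
  have "cut_bound X (Z N) \<le> frobenius (grad_mat (Z N)) (lift_data X ** G)"
    unfolding cut_bound_def min_over_attained[OF arg]
    using arg assms(1) by (simp add: is_arg_min_linorder)
  then show ?case
    using Suc by simp
qed

section \<open>Convergence of the gap\<close>

definition best_value ::
  "real ^ 'n ^ 'd::finite \<Rightarrow> (nat \<Rightarrow> real ^ 'k ^ 'n) \<Rightarrow> nat \<Rightarrow> real" where
  "best_value X \<Gamma> N = (MIN M\<in>{..N}. kmeans_F X (lift_data X ** \<Gamma> M))"

lemma upper_bound_eq_best_value: "upper_bound X \<Gamma> N = ereal (best_value X \<Gamma> N)"
proof (induction N)
  case 0
  then show ?case by (simp add: upper_bound_def best_value_def)
next
  case (Suc N)
  then show ?case
    by (simp add: upper_bound_def best_value_def atMost_Suc min.commute ereal_min)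
qed

text \<open>
  Strong induction, because iteration \<open>N\<close> is constrained only when no earlier stopping test
  succeeded. Once iterations \<open>0\<close> to \<open>N\<close> are known to take place, every candidate \<open>\<X>\<Gamma>\<^sub>M\<close> with \<open>M \<le> N\<close>
  is feasible for the relaxed problem over \<open>P\<^sub>N\<close>, so its value is at least \<open>L\<^sub>N\<close>.
\<close>

lemma run_never_stops:
  fixes X :: "real ^ 'n ^ 'd::finite"
    and Z :: "nat \<Rightarrow> real ^ 'k ^ 'd option"
    and \<Gamma> :: "nat \<Rightarrow> real ^ 'k ^ 'n"
  assumes run: "cutting_plane_run 0 X Z \<Gamma>"
  shows "\<not> gap X Z \<Gamma> N < ereal 0"
proof (induction N rule: less_induct)
  case (less N)
  then have step: "is_arg_min (kmeans_F X) (\<lambda>W. W \<in> polytope_seq X Z M) (Z M)"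
      "is_arg_min (\<lambda>G. frobenius (grad_mat (Z M)) (lift_data X ** G))
        (\<lambda>G. G \<in> relaxed_assignments) (\<Gamma> M)" if "M \<le> N" for M
    using run that unfolding cutting_plane_run_def by simp_all
  have "kmeans_F X (Z N) \<le> kmeans_F X (lift_data X ** \<Gamma> M)" if "M \<le> N" for M
  proof -
    have "\<Gamma> M \<in> relaxed_assignments"
      using step(2)[OF that] by (simp add: is_arg_min_def)
    then have "lift_data X ** \<Gamma> M \<in> polytope_seq X Z N"
      using step(2) by (rule lift_mult_in_polytope_seq) simp
    then show ?thesis
      using step(1)[of N] by (simp add: is_arg_min_linorder)
  qed
  then have "kmeans_F X (Z N) \<le> best_value X \<Gamma> N"
    by (simp add: best_value_def)
  then show ?case
    by (simp add: gap_def upper_bound_eq_best_value lower_bound_def)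
qed

text \<open>
  Consecutive members of a convergent subsequence get arbitrarily close.
\<close>

lemma bounded_sequence_close_pair:
  fixes z :: "nat \<Rightarrow> 'a::heine_borel"
  assumes "bounded (range z)" and "e > 0"
  shows "\<exists>N M. N < M \<and> dist (z M) (z N) < e"
proof -
  obtain l r where r: "strict_mono (r :: nat \<Rightarrow> nat)" and "(z \<circ> r) \<longlonglongrightarrow> l"
    using bounded_imp_convergent_subsequence[OF assms(1)] by blast
  then have "Cauchy (z \<circ> r)"
    by (simp add: LIMSEQ_imp_Cauchy)
  then obtain p where "dist ((z \<circ> r) (Suc p)) ((z \<circ> r) p) < e"
    using assms(2) unfolding Cauchy_def by (metis le_Suc_eq order_refl)
  then show ?thesis
    using r by (intro exI[of _ "r p"] exI[of _ "r (Suc p)"]) (simp add: strict_mono_def)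
qed

theorem theorem3p1:
  fixes X :: "real ^ 'n ^ 'd"
    and Z :: "nat \<Rightarrow> real ^ 'k ^ ('d::finite) option"
    and \<Gamma> :: "nat \<Rightarrow> real ^ 'k ^ 'n"
  assumes "CARD('k) \<le> CARD('n)"
    and "cutting_plane_run 0 X Z \<Gamma>"
  shows "(\<lambda>N. upper_bound X \<Gamma> N - ereal (lower_bound X Z N)) \<longlonglongrightarrow> 0"
proof -
  define L where "L N = lower_bound X Z N" for N
  define U where "U N = best_value X \<Gamma> N" for N
  have Z_opt: "is_arg_min (kmeans_F X) (\<lambda>W. W \<in> polytope_seq X Z N) (Z N)"
    and \<Gamma>_opt: "is_arg_min (\<lambda>G. frobenius (grad_mat (Z N)) (lift_data X ** G))
        (\<lambda>G. G \<in> relaxed_assignments) (\<Gamma> N)" for N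
    using assms(2) run_never_stops[OF assms(2)] unfolding cutting_plane_run_def by blast+
  have \<Gamma>_mem: "\<Gamma> N \<in> relaxed_assignments" for N
    using \<Gamma>_opt by (simp add: is_arg_min_def)
  have Z_mem: "Z M \<in> polytope_seq X Z N" if "N \<le> M" for M N
    using Z_opt[of M] polytope_seq_antimono[OF that, of X Z] by (auto simp: is_arg_min_def)
  have Z_init: "Z N \<in> initial_polytope X" for N
    using Z_mem[of 0 N] by simp
  have Z_ge: "1 \<le> Z N $ None $ j" for N j
    using \<Gamma>_mem Z_init by (intro initial_polytope_None_ge_1) auto
  have bnd: "bounded (range Z)"
    by (rule bounded_subset[OF bounded_initial_polytope[of X]]) (use Z_init in auto)
  have "bounded (grad_mat ` range Z)"
    using bnd by (rule bounded_grad_mat) (auto simp: Z_ge)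
  then obtain K where K: "K > 0" "\<And>N. norm (grad_mat (Z N)) \<le> K"
    unfolding bounded_pos by auto

  \<comment> \<open>The gap at \<open>N\<close> is at most the violation of the cut \<open>N\<close> at \<open>Z N\<close>, and \<open>Z M\<close> already satisfies this cut.\<close>
  have gap_le: "U N - L N \<le> K * dist (Z M) (Z N)" if "N < M" for N M
  proof -
    have "U N - L N \<le> kmeans_F X (lift_data X ** \<Gamma> N) - kmeans_F X (Z N)"
      by (simp add: U_def L_def best_value_def lower_bound_def)
    also have "\<dots> \<le> frobenius (grad_mat (Z N)) (lift_data X ** \<Gamma> N)
        - frobenius (grad_mat (Z N)) (Z N)"
      by (rule kmeans_F_diff_le)
        (use Z_ge lift_mult_None_ge_1[OF \<Gamma>_mem] in \<open>force intro: less_le_trans[OF zero_less_one]\<close>)+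
    also have "frobenius (grad_mat (Z N)) (lift_data X ** \<Gamma> N) = cut_bound X (Z N)"
      unfolding cut_bound_def min_over_attained[OF \<Gamma>_opt] ..
    also have "\<dots> \<le> frobenius (grad_mat (Z N)) (Z M)"
      using Z_mem[of "Suc N" M] that by simp
    also have "frobenius (grad_mat (Z N)) (Z M) - frobenius (grad_mat (Z N)) (Z N)
        = grad_mat (Z N) \<bullet> (Z M - Z N)"
      by (simp add: frobenius_eq_inner inner_diff_right)
    also have "\<dots> \<le> norm (grad_mat (Z N)) * norm (Z M - Z N)"
      by (rule norm_cauchy_schwarz)
    also have "\<dots> \<le> K * dist (Z M) (Z N)"
      unfolding dist_norm by (intro mult_right_mono K) simp
    finally show ?thesis by simp
  qed

  have gap_antimono: "U M - L M \<le> U N - L N" if "N \<le> M" for N M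
  proof -
    have "U M \<le> U N"
      unfolding U_def best_value_def using that by (intro Min_antimono) auto
    moreover have "L N \<le> L M"
      using Z_opt[of N] Z_mem[OF that] by (simp add: L_def lower_bound_def is_arg_min_linorder)
    ultimately show ?thesis by simp
  qed

  have gap_nonneg: "0 \<le> U N - L N" for N
    using run_never_stops[OF assms(2), of N]
    by (simp add: gap_def upper_bound_eq_best_value U_def L_def)

  have "(\<lambda>N. U N - L N) \<longlonglongrightarrow> 0"
  proof (rule LIMSEQ_I)
    fix e :: real assume "e > 0"
    then obtain N M where "N < M" "dist (Z M) (Z N) < e / K"
      using bounded_sequence_close_pair[OF bnd, of "e / K"] K(1) by auto
    then have "U N - L N < e"
      using gap_le[of N M] K(1) by (simp add: pos_less_divide_eq mult.commute)
    then show "\<exists>N. \<forall>M\<ge>N. norm (U M - L M - 0) < e"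
      using gap_antimono gap_nonneg by (intro exI[of _ N]) (auto intro: le_less_trans)
  qed
  then show ?thesis
    by (simp add: upper_bound_eq_best_value U_def L_def flip: zero_ereal_def lim_ereal)
qed

end
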